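(* Let $a>0$ and let $L$ be a bounded $a$-factorable linear operator from $L^2(\mathbb R)$ to $L^1[0,a]$. Then there exists a function $g\in L^2(\mathbb R)$ such that $L(f)=\langle f,g\rangle_a$ (as functions on $[0,a]$) for all $f\in L^2(\mathbb R)$, and $\|L\|=\|g\|_{L^2(\mathbb R)}$.
   Context: For $f,g\in L^2(\mathbb R)$ (complex-valued), the $a$-inner product is the $a$-periodic function $\langle f,g\rangle_a(t)=\sum_{n\in\mathbb Z}f(t-na)\overline{g(t-na)}$ (the series converges unconditionally a.e. and its restriction to $[0,a]$ lies in $L^1[0,a]$). A linear operator $L:L^2(\mathbb R)\to L^p(E)$ ($E\subset\mathbb R$ measurable, $1\le p\le\infty$) is $a$-factorable if for any factorization $f=\phi g$, where $f,g\in L^2(\mathbb R)$ and $\phi$ is a (measurable) $a$-periodic function on $\mathbb R$, we have $L(f)=L(\phi g)=\phi L(g)$. *)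

theory Defs
  imports "HOL-Analysis.Analysis"
begin

text \<open>
  Elements of the (complex) spaces \<open>L\<^sup>p\<close>, for finite \<open>p \<ge> 1\<close>, are represented by functions;
  equality of elements is equality almost everywhere. For a measurable set \<open>E\<close> of reals,
  \<open>L\<^sup>p(E)\<close> is \<open>Lp p (lebesgue_on E)\<close>; values of representatives outside \<open>E\<close> are irrelevant.
\<close>

definition Lp :: "real \<Rightarrow> 'a measure \<Rightarrow> ('a \<Rightarrow> complex) set" where
  "Lp p M = {f \<in> borel_measurable M. integrable M (\<lambda>x. norm (f x) powr p)}"

definition Lp_norm :: "real \<Rightarrow> 'a measure \<Rightarrow> ('a \<Rightarrow> complex) \<Rightarrow> real" where
  "Lp_norm p M f = (\<integral>x. norm (f x) powr p \<partial>M) powr (1 / p)"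

text \<open>
  The second conjunct says that \<open>L\<close> descends to classes modulo almost-everywhere equality.
\<close>

definition Lp_linear ::
  "real \<Rightarrow> 'a measure \<Rightarrow> real \<Rightarrow> 'b measure \<Rightarrow> (('a \<Rightarrow> complex) \<Rightarrow> 'b \<Rightarrow> complex) \<Rightarrow> bool" where
  "Lp_linear p M q N L \<longleftrightarrow>
     (\<forall>f\<in>Lp p M. L f \<in> Lp q N) \<and>
     (\<forall>f\<in>Lp p M. \<forall>g\<in>Lp p M. (AE x in M. f x = g x) \<longrightarrow> (AE y in N. L f y = L g y)) \<and>
     (\<forall>f\<in>Lp p M. \<forall>g\<in>Lp p M. AE y in N. L (\<lambda>x. f x + g x) y = L f y + L g y) \<and>
     (\<forall>c. \<forall>f\<in>Lp p M. AE y in N. L (\<lambda>x. c * f x) y = c * L f y)"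

definition Lp_bounded ::
  "real \<Rightarrow> 'a measure \<Rightarrow> real \<Rightarrow> 'b measure \<Rightarrow> (('a \<Rightarrow> complex) \<Rightarrow> 'b \<Rightarrow> complex) \<Rightarrow> bool" where
  "Lp_bounded p M q N L \<longleftrightarrow> (\<exists>C. \<forall>f\<in>Lp p M. Lp_norm q N (L f) \<le> C * Lp_norm p M f)"

text \<open>A real supremum, hence meaningful only for bounded operators.\<close>

definition Lp_opnorm ::
  "real \<Rightarrow> 'a measure \<Rightarrow> real \<Rightarrow> 'b measure \<Rightarrow> (('a \<Rightarrow> complex) \<Rightarrow> 'b \<Rightarrow> complex) \<Rightarrow> real" where
  "Lp_opnorm p M q N L = (SUP f\<in>{f \<in> Lp p M. Lp_norm p M f \<le> 1}. Lp_norm q N (L f))"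

text \<open>
  The library's infinite sum is the unconditional one; it is \<open>0\<close> at the points where the family
  is not summable, which form a null set when \<open>f\<close> and \<open>g\<close> are square integrable and \<open>a > 0\<close>.
\<close>

definition a_inner :: "real \<Rightarrow> (real \<Rightarrow> complex) \<Rightarrow> (real \<Rightarrow> complex) \<Rightarrow> real \<Rightarrow> complex" where
  "a_inner a f g t =
     (\<Sum>\<^sub>\<infinity>n\<in>(UNIV :: int set). f (t - of_int n * a) * cnj (g (t - of_int n * a)))"

text \<open>
  The exponent of the target space \<open>L\<^sup>p(E)\<close> plays no role in factorability: both the
  factorization and the conclusion are identities almost everywhere.
\<close>

definition a_factorable ::
  "real \<Rightarrow> real set \<Rightarrow> ((real \<Rightarrow> complex) \<Rightarrow> real \<Rightarrow> complex) \<Rightarrow> bool" where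
  "a_factorable a E L \<longleftrightarrow>
     (\<forall>f\<in>Lp 2 lebesgue. \<forall>g\<in>Lp 2 lebesgue. \<forall>\<phi>\<in>borel_measurable lebesgue.
        (\<forall>t. \<phi> (t + a) = \<phi> t) \<longrightarrow> (AE t in lebesgue. f t = \<phi> t * g t) \<longrightarrow>
        (AE t in lebesgue_on E. L f t = \<phi> t * L g t))"

end

theory Submission
  imports Defs
begin

text \<open>
  Integrating over one period turns \<open>L\<close> into the bounded functional
  \<open>\<Lambda> f = \<integral>\<^bsub>[0,a]\<^esub> L f\<close> on \<open>L\<^sup>2\<close>, which the Riesz representation theorem writes as
  \<open>f \<mapsto> \<integral> f \<cdot> cnj g\<close>. Unfolding this integral over the translates of the period gives
  \<open>\<Lambda> f = \<integral>\<^bsub>[0,a]\<^esub> \<langle>f,g\<rangle>\<^sub>a\<close>. Replacing \<open>f\<close> by its product with the indicator of a periodic set,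
  factorability shows that \<open>L f\<close> and \<open>\<langle>f,g\<rangle>\<^sub>a\<close> have the same integral over every measurable subset
  of the period, hence agree almost everywhere. The norm identity is Cauchy--Schwarz, with equality
  at \<open>f = g / \<parallel>g\<parallel>\<close>.

  The Riesz theorem is obtained by minimizing \<open>\<parallel>f\<parallel>\<^sup>2 - 2 Re (\<Lambda> f)\<close>: by the parallelogram law a
  minimizing sequence is Cauchy.
\<close>

section \<open>Elementary facts about \<open>L^1\<close> and \<open>L^2\<close>: closure properties,
  Cauchy-Schwarz, the squared norm\<close>

lemma Lp2_iff:
  "f \<in> Lp 2 M \<longleftrightarrow> f \<in> borel_measurable M \<and> integrable M (\<lambda>x. (cmod (f x))\<^sup>2)"
  by (simp add: Lp_def)

lemma Lp2_norm: "Lp_norm 2 M f = sqrt (\<integral>x. (cmod (f x))\<^sup>2 \<partial>M)"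
  by (simp add: Lp_norm_def powr_half_sqrt)

lemma Lp2_norm_square: "(Lp_norm 2 M f)\<^sup>2 = (\<integral>x. (cmod (f x))\<^sup>2 \<partial>M)"
  by (simp add: Lp2_norm)

lemma Lp1_iff: "f \<in> Lp 1 M \<longleftrightarrow> integrable M f"
  by (auto simp: Lp_def integrable_norm_iff)

lemma Lp1_norm: "Lp_norm 1 M f = (\<integral>x. cmod (f x) \<partial>M)"
  by (simp add: Lp_norm_def)

lemma integrable_dominated:
  fixes g :: "'a \<Rightarrow> 'b :: {banach, second_countable_topology}" and f :: "'a \<Rightarrow> real"
  assumes "integrable M f" "g \<in> borel_measurable M" "\<And>x. norm (g x) \<le> f x"
  shows "integrable M g"
  by (rule Bochner_Integration.integrable_bound[OF assms(1,2)])
    (use assms(3) order_trans[OF _ abs_ge_self] in auto)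

lemma Lp2_lincomb:
  assumes "f \<in> Lp 2 M" "g \<in> Lp 2 M"
  shows "(\<lambda>x. c * f x + d * g x) \<in> Lp 2 M"
proof -
  have [measurable]: "f \<in> borel_measurable M" "g \<in> borel_measurable M"
    using assms by (auto simp: Lp2_iff)
  have int: "integrable M (\<lambda>x. 2 * ((cmod c)\<^sup>2 * (cmod (f x))\<^sup>2 + (cmod d)\<^sup>2 * (cmod (g x))\<^sup>2))"
    using assms by (auto simp: Lp2_iff)
  have le: "norm ((cmod (c * u + d * v))\<^sup>2) \<le> 2 * ((cmod c)\<^sup>2 * (cmod u)\<^sup>2 + (cmod d)\<^sup>2 * (cmod v)\<^sup>2)"
    for u v
  proof -
    have "(cmod (c * u + d * v))\<^sup>2 \<le> (cmod (c * u) + cmod (d * v))\<^sup>2"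
      by (intro power_mono norm_triangle_ineq) auto
    also have "\<dots> \<le> 2 * ((cmod (c * u))\<^sup>2 + (cmod (d * v))\<^sup>2)"
      using sum_squares_bound[of "cmod (c * u)" "cmod (d * v)"] by (simp add: power2_sum)
    finally show ?thesis by (simp add: norm_mult power_mult_distrib)
  qed
  have "integrable M (\<lambda>x. (cmod (c * f x + d * g x))\<^sup>2)"
    by (rule integrable_dominated[OF int _ le]) measurable
  then show ?thesis by (simp add: Lp2_iff)
qed

lemma Lp2_cmult: "f \<in> Lp 2 M \<Longrightarrow> (\<lambda>x. c * f x) \<in> Lp 2 M"
  using Lp2_lincomb[of f M f c 0] by simp

lemma Lp2_add: "f \<in> Lp 2 M \<Longrightarrow> g \<in> Lp 2 M \<Longrightarrow> (\<lambda>x. f x + g x) \<in> Lp 2 M"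
  using Lp2_lincomb[of f M g 1 1] by simp

lemma Lp2_diff: "f \<in> Lp 2 M \<Longrightarrow> g \<in> Lp 2 M \<Longrightarrow> (\<lambda>x. f x - g x) \<in> Lp 2 M"
  using Lp2_lincomb[of f M g 1 "-1"] by simp

text \<open>Used with \<open>\<phi>\<close> the indicator of a periodic set, so that cutting
  \<open>f\<close> down to that set stays in the domain of \<open>L\<close>.\<close>

lemma Lp2_bounded_mult:
  assumes "f \<in> Lp 2 M" "\<phi> \<in> borel_measurable M" "\<And>x. cmod (\<phi> x) \<le> 1"
  shows "(\<lambda>x. \<phi> x * f x) \<in> Lp 2 M"
proof -
  have [measurable]: "f \<in> borel_measurable M" "\<phi> \<in> borel_measurable M"
    using assms by (auto simp: Lp2_iff)
  have int: "integrable M (\<lambda>x. (cmod (f x))\<^sup>2)" using assms by (simp add: Lp2_iff)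
  have le: "norm ((cmod (\<phi> x * f x))\<^sup>2) \<le> (cmod (f x))\<^sup>2" for x
    using mult_left_le_one_le[OF _ _ assms(3)[of x], of "cmod (f x)"]
    by (simp add: norm_mult power_mono)
  have "integrable M (\<lambda>x. (cmod (\<phi> x * f x))\<^sup>2)"
    by (rule integrable_dominated[OF int _ le]) measurable
  then show ?thesis by (simp add: Lp2_iff)
qed

lemma Lp2_integrable_mult_cnj:
  assumes "f \<in> Lp 2 M" "g \<in> Lp 2 M"
  shows "integrable M (\<lambda>x. f x * cnj (g x))"
proof -
  have [measurable]: "f \<in> borel_measurable M" "g \<in> borel_measurable M"
    using assms by (auto simp: Lp2_iff)
  have [measurable]: "(\<lambda>x. cnj (g x)) \<in> borel_measurable M"
    by (rule borel_measurable_continuous_on[OF continuous_on_cnj]) (auto intro: continuous_on_id)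
  have int: "integrable M (\<lambda>x. (cmod (f x))\<^sup>2 + (cmod (g x))\<^sup>2)"
    using assms by (auto simp: Lp2_iff)
  have le: "cmod (u * cnj v) \<le> (cmod u)\<^sup>2 + (cmod v)\<^sup>2" for u v
    unfolding norm_mult complex_mod_cnj
    using sum_squares_bound[of "cmod u" "cmod v"] zero_le_power2[of "cmod u"]
      zero_le_power2[of "cmod v"] by linarith
  show ?thesis
    by (rule integrable_dominated[OF int _ le]) measurable
qed

text \<open>Transferred from the inequality for nonnegative integrals; square integrability makes
  all three integrals finite. The modulus stands inside the integral because the \<open>L^1\<close>
  norm of the inner product is to be bounded, not just its integral.\<close>

lemma Lp2_Cauchy_Schwarz:
  assumes "f \<in> Lp 2 M" "g \<in> Lp 2 M"
  shows "(\<integral>x. cmod (f x * cnj (g x)) \<partial>M) \<le> Lp_norm 2 M f * Lp_norm 2 M g"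
proof -
  have [measurable]: "f \<in> borel_measurable M" "g \<in> borel_measurable M"
    and int: "integrable M (\<lambda>x. (cmod (f x))\<^sup>2)" "integrable M (\<lambda>x. (cmod (g x))\<^sup>2)"
    using assms by (auto simp: Lp2_iff)
  have "(\<integral>\<^sup>+x. ennreal (cmod (f x)) * ennreal (cmod (g x)) \<partial>M)\<^sup>2
      \<le> (\<integral>\<^sup>+x. (ennreal (cmod (f x)))\<^sup>2 \<partial>M) * (\<integral>\<^sup>+x. (ennreal (cmod (g x)))\<^sup>2 \<partial>M)"
    by (rule Cauchy_Schwarz_nn_integral) auto
  also have "(\<integral>\<^sup>+x. ennreal (cmod (f x)) * ennreal (cmod (g x)) \<partial>M)
      = ennreal (\<integral>x. cmod (f x * cnj (g x)) \<partial>M)"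
    using integrable_norm[OF Lp2_integrable_mult_cnj[OF assms]]
    by (subst nn_integral_eq_integral[symmetric]) (auto simp: ennreal_mult norm_mult)
  also have "(\<integral>\<^sup>+x. (ennreal (cmod (f x)))\<^sup>2 \<partial>M) = ennreal (\<integral>x. (cmod (f x))\<^sup>2 \<partial>M)"
    using int by (subst nn_integral_eq_integral[symmetric]) (auto simp: ennreal_power)
  also have "(\<integral>\<^sup>+x. (ennreal (cmod (g x)))\<^sup>2 \<partial>M) = ennreal (\<integral>x. (cmod (g x))\<^sup>2 \<partial>M)"
    using int by (subst nn_integral_eq_integral[symmetric]) (auto simp: ennreal_power)
  finally have "(\<integral>x. cmod (f x * cnj (g x)) \<partial>M)\<^sup>2
      \<le> (\<integral>x. (cmod (f x))\<^sup>2 \<partial>M) * (\<integral>x. (cmod (g x))\<^sup>2 \<partial>M)"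
    by (simp add: ennreal_power ennreal_mult[symmetric])
  then show ?thesis
    by (simp add: Lp2_norm real_sqrt_mult[symmetric] real_le_rsqrt)
qed

text \<open>Real coefficients leave only the real part of the inner product in the cross term.
  Coefficients \<open>1/2, 1/2\<close> and \<open>1, -1\<close> give the parallelogram law;
  coefficients \<open>1, t\<close> give the perturbation of a near-minimizer.\<close>

lemma Lp2_integral_square_lincomb:
  fixes c d :: real and f g :: "'a \<Rightarrow> complex"
  assumes "f \<in> Lp 2 M" "g \<in> Lp 2 M"
  shows "(\<integral>x. (cmod (c * f x + d * g x))\<^sup>2 \<partial>M)
    = c\<^sup>2 * (\<integral>x. (cmod (f x))\<^sup>2 \<partial>M) + 2 * c * d * Re (\<integral>x. f x * cnj (g x) \<partial>M)
      + d\<^sup>2 * (\<integral>x. (cmod (g x))\<^sup>2 \<partial>M)"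
proof -
  have int: "integrable M (\<lambda>x. (cmod (f x))\<^sup>2)" "integrable M (\<lambda>x. (cmod (g x))\<^sup>2)"
    "integrable M (\<lambda>x. f x * cnj (g x))"
    using assms Lp2_integrable_mult_cnj[OF assms] by (auto simp: Lp2_iff)
  have int': "integrable M (\<lambda>x. Re (f x * cnj (g x)))"
    using int by (intro integrable_Re)
  have "(cmod (c * u + d * v))\<^sup>2 = c\<^sup>2 * (cmod u)\<^sup>2 + 2 * c * d * Re (u * cnj v) + d\<^sup>2 * (cmod v)\<^sup>2"
    for u v :: complex
    unfolding cmod_power2 by (simp add: power2_eq_square algebra_simps)
  then have "(\<integral>x. (cmod (c * f x + d * g x))\<^sup>2 \<partial>M)
     = (\<integral>x. c\<^sup>2 * (cmod (f x))\<^sup>2 + 2 * c * d * Re (f x * cnj (g x)) + d\<^sup>2 * (cmod (g x))\<^sup>2 \<partial>M)"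
    by presburger
  also have "\<dots> = c\<^sup>2 * (\<integral>x. (cmod (f x))\<^sup>2 \<partial>M) + 2 * c * d * (\<integral>x. Re (f x * cnj (g x)) \<partial>M)
      + d\<^sup>2 * (\<integral>x. (cmod (g x))\<^sup>2 \<partial>M)"
    using int int' by (simp del: times_complex.simps)
  finally show ?thesis using int by (simp del: times_complex.simps)
qed

section \<open>Completeness of \<open>L^2\<close>\<close>

text \<open>By monotone convergence the sum of the norms has a finite integral, so it is finite
  almost everywhere.\<close>

lemma AE_summable_norm:
  fixes u :: "nat \<Rightarrow> 'a \<Rightarrow> 'b :: {banach, second_countable_topology}"
  assumes "\<And>i. integrable M (u i)" "summable (\<lambda>i. \<integral>x. norm (u i x) \<partial>M)"
  shows "AE x in M. summable (\<lambda>i. norm (u i x))"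
proof -
  have [measurable]: "u i \<in> borel_measurable M" for i
    using assms(1) by auto
  have "(\<integral>\<^sup>+x. (\<Sum>i. ennreal (norm (u i x))) \<partial>M) = (\<Sum>i. \<integral>\<^sup>+x. ennreal (norm (u i x)) \<partial>M)"
    by (rule nn_integral_suminf) auto
  also have "\<dots> = (\<Sum>i. ennreal (\<integral>x. norm (u i x) \<partial>M))"
    using assms(1) by (simp add: nn_integral_eq_integral)
  also have "\<dots> \<noteq> \<infinity>"
    unfolding infinity_ennreal_def by (rule ennreal_suminf_neq_top[OF assms(2)]) simp
  finally have "AE x in M. (\<Sum>i. ennreal (norm (u i x))) \<noteq> \<infinity>"
    by (intro nn_integral_PInf_AE) auto
  then show ?thesis
    by eventually_elim (rule summable_suminf_not_top, simp_all)
qed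

text \<open>Completeness for sequences with geometrically small increments. The minimizing sequence
  in the Riesz theorem is chosen to converge this fast, so no subsequence has to be
  extracted.\<close>

lemma Lp2_rapidly_Cauchy_converges:
  assumes f: "\<And>n. f n \<in> Lp 2 M"
    and le: "\<And>n. (\<integral>x. (cmod (f (Suc n) x - f n x))\<^sup>2 \<partial>M) \<le> (1/16) ^ n"
  obtains h where "h \<in> Lp 2 M" "(\<lambda>n. Lp_norm 2 M (\<lambda>x. f n x - h x)) \<longlonglongrightarrow> 0"
proof -
  have [measurable]: "f n \<in> borel_measurable M" for n
    using f by (auto simp: Lp2_iff)
  \<comment> \<open>The weights \<open>4 ^ n\<close> leave the series of integrals summable, and convergence of \<open>\<Sum>n. u n x\<close>
    bounds \<open>cmod (f (Suc n) x - f n x)\<close> by a multiple of \<open>(1/2) ^ n\<close>, so no Minkowski inequality is needed.\<close>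
  define u where "u n x = 4 ^ n * (cmod (f (Suc n) x - f n x))\<^sup>2" for n x
  have [measurable]: "u n \<in> borel_measurable M" for n
    unfolding u_def by measurable
  have u0: "u n x \<ge> 0" for n x by (simp add: u_def)
  have iu: "integrable M (u n)" for n
    unfolding u_def using Lp2_diff[OF f[of "Suc n"] f[of n]] by (auto simp: Lp2_iff)
  have su: "summable (\<lambda>n. \<integral>x. norm (u n x) \<partial>M)"
  proof (rule summable_comparison_test')
    show "summable (\<lambda>n. (1/4::real) ^ n)" by (simp add: summable_geometric)
    fix n :: nat
    have "norm (\<integral>x. norm (u n x) \<partial>M) = 4 ^ n * (\<integral>x. (cmod (f (Suc n) x - f n x))\<^sup>2 \<partial>M)"
      using u0 by (simp add: u_def)
    also have "\<dots> \<le> 4 ^ n * (1/16) ^ n" using le by (intro mult_left_mono) auto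
    also have "\<dots> = (1/4) ^ n" by (simp add: power_mult_distrib[symmetric])
    finally show "norm (\<integral>x. norm (u n x) \<partial>M) \<le> (1/4) ^ n" .
  qed
  have AE_u: "AE x in M. summable (\<lambda>n. norm (u n x))"
    by (rule AE_summable_norm[OF iu su])
  define G where "G x = (\<Sum>n. u n x)" for x
  have iG: "integrable M G"
    unfolding G_def by (rule integrable_suminf[OF iu AE_u su])
  \<comment> \<open>The pointwise \<open>lim\<close> of measurable functions is measurable whether
    or not it exists everywhere; its values on the exceptional null set do not affect the
    integrals.\<close>
  define h where "h x = lim (\<lambda>n. f n x)" for x
  have [measurable]: "h \<in> borel_measurable M"
    unfolding h_def by (rule borel_measurable_lim_metric) auto
  have bound: "AE x in M. \<forall>n. (cmod (f n x - h x))\<^sup>2 \<le> 4 * G x * (1/4) ^ n"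
    using AE_u
  proof eventually_elim
    case (elim x)
    then have sx: "summable (\<lambda>n. u n x)" using u0 by simp
    have G0: "G x \<ge> 0" unfolding G_def using sx u0 by (simp add: suminf_nonneg)
    have d: "cmod (f (Suc n) x - f n x) \<le> sqrt (G x) * (1/2) ^ n" for n
    proof (rule power2_le_imp_le)
      have "u n x \<le> G x"
        unfolding G_def using sum_le_suminf[OF sx, of "{n}"] u0 by simp
      moreover have "((2::real) ^ n)\<^sup>2 = 4 ^ n"
        by (simp add: power2_eq_square power_mult_distrib[symmetric])
      ultimately show "(cmod (f (Suc n) x - f n x))\<^sup>2 \<le> (sqrt (G x) * (1/2) ^ n)\<^sup>2"
        using G0 by (simp add: u_def power_mult_distrib power_divide field_simps)
    qed (use G0 in auto)
    \<comment> \<open>The geometric tail from index \<open>n\<close>. By telescoping it dominates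
      \<open>h x - f n x\<close>; its factor 2 becomes the 4 in \<open>bound\<close> after
      squaring.\<close>
    have gs: "(\<lambda>k. sqrt (G x) * (1/2) ^ (k + n)) sums (2 * sqrt (G x) * (1/2) ^ n)" for n
      using sums_mult[OF geometric_sums[of "1/2::real"], of "sqrt (G x) * (1/2) ^ n"]
      by (simp add: power_add field_simps)
    have "summable (\<lambda>n. f (Suc n) x - f n x)"
      by (rule summable_comparison_test'[OF sums_summable[OF gs[of 0]]]) (use d in auto)
    then have "convergent (\<lambda>n. \<Sum>k<n. f (Suc k) x - f k x)"
      by (simp add: summable_iff_convergent)
    then have "convergent (\<lambda>n. f n x - f 0 x)"
      unfolding sum_lessThan_telescope[of "\<lambda>k. f k x"] .
    then have "convergent (\<lambda>n. f n x)"
      by (simp add: convergent_diff_const_right_iff)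
    then have lim: "(\<lambda>n. f n x) \<longlonglongrightarrow> h x"
      by (simp add: h_def convergent_LIMSEQ_iff)
    show ?case
    proof
      fix n
      have "(\<lambda>k. f (k + n) x) \<longlonglongrightarrow> h x"
        by (rule LIMSEQ_ignore_initial_segment[OF lim])
      from telescope_sums[OF this]
      have "(\<lambda>k. f (Suc (k + n)) x - f (k + n) x) sums (h x - f n x)" by simp
      then have eq: "h x - f n x = (\<Sum>k. f (Suc (k + n)) x - f (k + n) x)"
        by (simp add: sums_iff)
      have "cmod (h x - f n x) \<le> (\<Sum>k. sqrt (G x) * (1/2) ^ (k + n))"
        unfolding eq by (rule norm_suminf_le[OF d sums_summable[OF gs]])
      then have "cmod (f n x - h x) \<le> 2 * sqrt (G x) * (1/2) ^ n"
        using gs[of n] by (simp add: sums_iff norm_minus_commute)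
      then have "(cmod (f n x - h x))\<^sup>2 \<le> (2 * sqrt (G x) * (1/2) ^ n)\<^sup>2"
        by (intro power_mono) auto
      moreover have "((2::real) ^ n)\<^sup>2 = 4 ^ n"
        by (simp add: power2_eq_square power_mult_distrib[symmetric])
      ultimately show "(cmod (f n x - h x))\<^sup>2 \<le> 4 * G x * (1/4) ^ n"
        using G0 by (simp add: power_mult_distrib power_divide)
    qed
  qed
  have i: "integrable M (\<lambda>x. (cmod (f n x - h x))\<^sup>2)" for n
  proof (rule Bochner_Integration.integrable_bound)
    show "integrable M (\<lambda>x. 4 * G x * (1/4) ^ n)" using iG by auto
    show "AE x in M. norm ((cmod (f n x - h x))\<^sup>2) \<le> norm (4 * G x * (1/4) ^ n)"
      using bound
    proof eventually_elim
      case (elim x)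
      then have "(cmod (f n x - h x))\<^sup>2 \<le> 4 * G x * (1/4) ^ n" ..
      then show ?case
        unfolding real_norm_def abs_power2 by (rule order_trans[OF _ abs_ge_self])
    qed
  qed auto
  \<comment> \<open>Membership of \<open>h\<close> follows by writing it as
    \<open>f 0 - (f 0 - h)\<close>.\<close>
  have "(\<lambda>x. f 0 x - h x) \<in> Lp 2 M" using i[of 0] by (simp add: Lp2_iff)
  from Lp2_diff[OF f[of 0] this] have h: "h \<in> Lp 2 M" by simp
  have "(\<lambda>n. \<integral>x. (cmod (f n x - h x))\<^sup>2 \<partial>M) \<longlonglongrightarrow> 0"
  proof (rule tendsto_sandwich[OF _ _ tendsto_const])
    show "\<forall>\<^sub>F n in sequentially. (\<integral>x. (cmod (f n x - h x))\<^sup>2 \<partial>M) \<le> 4 * (\<integral>x. G x \<partial>M) * (1/4) ^ n"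
    proof (intro always_eventually allI)
      fix n
      have "(\<integral>x. (cmod (f n x - h x))\<^sup>2 \<partial>M) \<le> (\<integral>x. 4 * G x * (1/4) ^ n \<partial>M)"
        using i[of n] iG bound by (intro integral_mono_AE) auto
      then show "(\<integral>x. (cmod (f n x - h x))\<^sup>2 \<partial>M) \<le> 4 * (\<integral>x. G x \<partial>M) * (1/4) ^ n" by simp
    qed
    show "(\<lambda>n. 4 * (\<integral>x. G x \<partial>M) * (1/4) ^ n) \<longlonglongrightarrow> 0"
      by (intro tendsto_mult_right_zero LIMSEQ_realpow_zero) auto
  qed auto
  then have "(\<lambda>n. Lp_norm 2 M (\<lambda>x. f n x - h x)) \<longlonglongrightarrow> 0"
    unfolding Lp2_norm using tendsto_real_sqrt by fastforce
  with h show ?thesis by (rule that)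
qed

section \<open>The Riesz representation theorem\<close>

text \<open>The representation is not read off from minimality of the limit \<open>g\<close>. Each
  near-minimizer \<open>f n\<close> already satisfies it up to an error of order
  \<open>(1/2) ^ n\<close>, and both sides pass to the limit.\<close>

lemma Lp2_Riesz_real:
  fixes R :: "('a \<Rightarrow> complex) \<Rightarrow> real"
  assumes add: "\<And>f g. f \<in> Lp 2 M \<Longrightarrow> g \<in> Lp 2 M \<Longrightarrow> R (\<lambda>x. f x + g x) = R f + R g"
    and scale: "\<And>(c::real) (f :: 'a \<Rightarrow> complex). f \<in> Lp 2 M \<Longrightarrow> R (\<lambda>x. c * f x) = c * R f"
    and bound: "\<And>f. f \<in> Lp 2 M \<Longrightarrow> R f \<le> C * Lp_norm 2 M f"
  obtains g where "g \<in> Lp 2 M" "\<And>f. f \<in> Lp 2 M \<Longrightarrow> R f = Re (\<integral>x. f x * cnj (g x) \<partial>M)"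
proof -
  define N where "N f = (\<integral>x. (cmod (f x))\<^sup>2 \<partial>M)" for f :: "'a \<Rightarrow> complex"
  define ip where "ip f g = Re (\<integral>x. f x * cnj (g x) \<partial>M)" for f g :: "'a \<Rightarrow> complex"
  define J where "J f = N f - 2 * R f" for f
  have N0: "N f \<ge> 0" for f by (simp add: N_def)
  have N_eq: "N f = (Lp_norm 2 M f)\<^sup>2" for f by (simp add: N_def Lp2_norm_square)
  have N_lincomb: "N (\<lambda>x. complex_of_real c * f x + complex_of_real d * g x)
      = c\<^sup>2 * N f + 2 * c * d * ip f g + d\<^sup>2 * N g"
    if "f \<in> Lp 2 M" "g \<in> Lp 2 M" for c d f g
    unfolding N_def ip_def by (rule Lp2_integral_square_lincomb[OF that])
  have R_lincomb: "R (\<lambda>x. complex_of_real c * f x + complex_of_real d * g x) = c * R f + d * R g"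
    if "f \<in> Lp 2 M" "g \<in> Lp 2 M" for c d f g
    using that by (simp add: add scale Lp2_cmult)
  \<comment> \<open>With \<open>x\<close> the norm of \<open>f\<close>, \<open>J f\<close> is at
    least \<open>x^2 - 2 * C * x = (x - C)^2 - C^2\<close>.\<close>
  have "J f \<ge> - C\<^sup>2" if "f \<in> Lp 2 M" for f
    using bound[OF that] zero_le_power2[of "Lp_norm 2 M f - C"]
    by (simp add: J_def N_eq power2_diff mult.commute)
  then have bdd: "bdd_below (J ` Lp 2 M)" by (auto intro!: bdd_belowI2)
  define m where "m = Inf (J ` Lp 2 M)"
  have m: "m \<le> J f" if "f \<in> Lp 2 M" for f
    unfolding m_def using bdd that by (intro cInf_lower) auto
  \<comment> \<open>The parallelogram law below bounds the squared increments by
    \<open>2 * \<epsilon> (Suc n) + 2 * \<epsilon> n\<close>. This is at most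
    \<open>4 * \<epsilon> n = (1/16) ^ n\<close>, the rate that the completeness lemma asks
    for.\<close>
  define \<epsilon> where "\<epsilon> n = (1/16 :: real) ^ n / 4" for n :: nat
  have \<epsilon>: "\<epsilon> n > 0" for n by (simp add: \<epsilon>_def)
  have "(\<lambda>x. 0) \<in> Lp 2 M" by (simp add: Lp2_iff)
  then have ne: "J ` Lp 2 M \<noteq> {}" by blast
  have "\<exists>f\<in>Lp 2 M. J f < m + \<epsilon> n" for n
    using cInf_lessD[OF ne, of "m + \<epsilon> n"] \<epsilon>[of n] by (auto simp: m_def)
  then obtain f where f: "\<And>n. f n \<in> Lp 2 M" and Jf: "\<And>n. J (f n) < m + \<epsilon> n" by metis
  have Cauchy: "N (\<lambda>x. f (Suc n) x - f n x) \<le> (1/16) ^ n" for n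
  proof -
    \<comment> \<open>The linear parts cancel: the squared distance of two functions is
      \<open>2 * J\<close> of the first plus \<open>2 * J\<close> of the second minus
      \<open>4 * J\<close> of their midpoint, and the last value is at least
      \<open>m\<close>.\<close>
    let ?mid = "\<lambda>x. complex_of_real (1/2) * f (Suc n) x + complex_of_real (1/2) * f n x"
    have "m \<le> J ?mid" by (intro m Lp2_lincomb f)
    also have "J ?mid = (N (f (Suc n)) + 2 * ip (f (Suc n)) (f n) + N (f n)) / 4 - R (f (Suc n)) - R (f n)"
      unfolding J_def N_lincomb[OF f f] R_lincomb[OF f f] by (simp add: power2_eq_square field_simps)
    finally have "N (f (Suc n)) - 2 * ip (f (Suc n)) (f n) + N (f n)
        \<le> 2 * J (f (Suc n)) + 2 * J (f n) - 4 * m" by (simp add: J_def field_simps)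
    also have "N (f (Suc n)) - 2 * ip (f (Suc n)) (f n) + N (f n) = N (\<lambda>x. f (Suc n) x - f n x)"
      using N_lincomb[OF f f, of 1 "Suc n" "-1" n] by simp
    also have "2 * J (f (Suc n)) + 2 * J (f n) - 4 * m \<le> 2 * \<epsilon> (Suc n) + 2 * \<epsilon> n"
      using Jf[of n] Jf[of "Suc n"] by simp
    also have "\<dots> \<le> (1/16) ^ n" by (simp add: \<epsilon>_def)
    finally show ?thesis .
  qed
  obtain g where g: "g \<in> Lp 2 M" and lim: "(\<lambda>n. Lp_norm 2 M (\<lambda>x. f n x - g x)) \<longlonglongrightarrow> 0"
    using Lp2_rapidly_Cauchy_converges[of f M] f Cauchy unfolding N_def by blast
  show ?thesis
  proof (rule that[OF g])
    fix h assume h: "h \<in> Lp 2 M"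
    have bd1: "norm (ip h (f n) - R h) \<le> (1/2) ^ n * (N h + 1)" for n
    proof -
      define b where "b = ip (f n) h - R h"
      \<comment> \<open>Moving from \<open>f n\<close> in direction \<open>h\<close> can lower
        \<open>J\<close> by at most \<open>\<epsilon> n\<close>; the coefficient \<open>b\<close> of
        the linear term is the error of the representation at \<open>f n\<close>.\<close>
      have quad: "0 \<le> \<epsilon> n + 2 * t * b + t\<^sup>2 * N h" for t
      proof -
        have "m \<le> J (\<lambda>x. complex_of_real 1 * f n x + complex_of_real t * h x)"
          by (intro m Lp2_lincomb f h)
        also have "\<dots> = J (f n) + 2 * t * b + t\<^sup>2 * N h"
          unfolding J_def N_lincomb[OF f h] R_lincomb[OF f h] b_def by (simp add: algebra_simps)
        finally show ?thesis using Jf[of n] by simp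
      qed
      \<comment> \<open>The step size is comparable to the square root of
        \<open>\<epsilon> n\<close>. Taking \<open>t = s\<close> and \<open>t = - s\<close> in
        \<open>quad\<close> and dividing by \<open>s\<close> bounds \<open>b\<close> from both sides
        by a multiple of \<open>s\<close>.\<close>
      define s where "s = (1/4::real) ^ n"
      have s: "s > 0" "\<epsilon> n = s\<^sup>2 / 4" "s \<le> (1/2) ^ n"
        by (auto simp: s_def \<epsilon>_def power2_eq_square power_mult_distrib[symmetric] intro: power_mono)
      have "2 * \<bar>b\<bar> \<le> s / 4 + s * N h"
      proof -
        have "s * (2 * b) \<le> s * (s / 4 + s * N h)" "s * (- 2 * b) \<le> s * (s / 4 + s * N h)"
          using quad[of s] quad[of "- s"] s(2) by (simp_all add: algebra_simps power2_eq_square)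
        then have "2 * b \<le> s / 4 + s * N h" "- 2 * b \<le> s / 4 + s * N h"
          using mult_le_cancel_left_pos[OF s(1)] by blast+
        then show ?thesis by simp
      qed
      also have "s / 4 + s * N h \<le> 2 * (s * (N h + 1))"
        using s(1) N0[of h] by (simp add: algebra_simps)
      finally have "\<bar>b\<bar> \<le> s * (N h + 1)" by simp
      also have "\<dots> \<le> (1/2) ^ n * (N h + 1)"
        using s(3) N0[of h] by (intro mult_right_mono) auto
      finally have "\<bar>b\<bar> \<le> (1/2) ^ n * (N h + 1)" .
      moreover have "ip (f n) h = ip h (f n)"
      proof -
        have "(\<integral>x. f n x * cnj (h x) \<partial>M) = cnj (\<integral>x. h x * cnj (f n x) \<partial>M)"
          unfolding Bochner_Integration.integral_cnj[symmetric] by (simp add: mult.commute)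
        then show ?thesis unfolding ip_def by simp
      qed
      ultimately show ?thesis by (simp add: b_def)
    qed
    have "(\<lambda>n. (1/2) ^ n * (N h + 1)) \<longlonglongrightarrow> 0"
      by (intro tendsto_mult_left_zero LIMSEQ_realpow_zero) auto
    then have "(\<lambda>n. ip h (f n) - R h) \<longlonglongrightarrow> 0"
      by (rule Lim_null_comparison[OF always_eventually[OF allI[OF bd1]]])
    then have 1: "(\<lambda>n. ip h (f n)) \<longlonglongrightarrow> R h"
      by (simp add: LIM_zero_iff)
    have bd2: "norm (ip h (f n) - ip h g) \<le> Lp_norm 2 M h * Lp_norm 2 M (\<lambda>x. f n x - g x)" for n
    proof -
      have "(\<integral>x. h x * cnj (f n x) \<partial>M) - (\<integral>x. h x * cnj (g x) \<partial>M)
          = (\<integral>x. h x * cnj (f n x - g x) \<partial>M)"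
        using Lp2_integrable_mult_cnj[OF h f] Lp2_integrable_mult_cnj[OF h g]
        by (subst Bochner_Integration.integral_diff[symmetric]) (simp_all add: algebra_simps)
      then have "\<bar>ip h (f n) - ip h g\<bar> \<le> cmod (\<integral>x. h x * cnj (f n x - g x) \<partial>M)"
        unfolding ip_def using abs_Re_le_cmod by (metis minus_complex.sel(1))
      also have "\<dots> \<le> (\<integral>x. cmod (h x * cnj (f n x - g x)) \<partial>M)"
        by (rule integral_norm_bound)
      also have "\<dots> \<le> Lp_norm 2 M h * Lp_norm 2 M (\<lambda>x. f n x - g x)"
        by (rule Lp2_Cauchy_Schwarz[OF h Lp2_diff[OF f g]])
      finally show ?thesis by simp
    qed
    have "(\<lambda>n. Lp_norm 2 M h * Lp_norm 2 M (\<lambda>x. f n x - g x)) \<longlonglongrightarrow> 0"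
      by (rule tendsto_mult_right_zero[OF lim])
    then have "(\<lambda>n. ip h (f n) - ip h g) \<longlonglongrightarrow> 0"
      by (rule Lim_null_comparison[OF always_eventually[OF allI[OF bd2]]])
    then have "(\<lambda>n. ip h (f n)) \<longlonglongrightarrow> ip h g"
      by (simp add: LIM_zero_iff)
    with 1 show "R h = Re (\<integral>x. h x * cnj (g x) \<partial>M)"
      unfolding ip_def[symmetric] by (rule LIMSEQ_unique)
  qed
qed

text \<open>The real parts determine everything: for a complex-linear functional the imaginary part
  at \<open>f\<close> is minus the real part at \<open>\<i> * f\<close>, and the integral obeys the
  same rule.\<close>

lemma Lp2_Riesz:
  fixes \<Lambda> :: "('a \<Rightarrow> complex) \<Rightarrow> complex"
  assumes add: "\<And>f g. f \<in> Lp 2 M \<Longrightarrow> g \<in> Lp 2 M \<Longrightarrow> \<Lambda> (\<lambda>x. f x + g x) = \<Lambda> f + \<Lambda> g"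
    and scale: "\<And>c f. f \<in> Lp 2 M \<Longrightarrow> \<Lambda> (\<lambda>x. c * f x) = c * \<Lambda> f"
    and bound: "\<And>f. f \<in> Lp 2 M \<Longrightarrow> cmod (\<Lambda> f) \<le> C * Lp_norm 2 M f"
  obtains g where "g \<in> Lp 2 M" "\<And>f. f \<in> Lp 2 M \<Longrightarrow> \<Lambda> f = (\<integral>x. f x * cnj (g x) \<partial>M)"
proof -
  obtain g where g: "g \<in> Lp 2 M"
    and Re_eq: "\<And>f. f \<in> Lp 2 M \<Longrightarrow> Re (\<Lambda> f) = Re (\<integral>x. f x * cnj (g x) \<partial>M)"
  proof (rule Lp2_Riesz_real[of M "\<lambda>f. Re (\<Lambda> f)" C])
    show "Re (\<Lambda> f) \<le> C * Lp_norm 2 M f" if "f \<in> Lp 2 M" for f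
      using bound[OF that] complex_Re_le_cmod[of "\<Lambda> f"] by linarith
  qed (auto simp: add scale)
  show ?thesis
  proof (rule that[OF g complex_eqI[OF Re_eq]])
    fix f assume f: "f \<in> Lp 2 M"
    have "Re (\<Lambda> (\<lambda>x. \<i> * f x)) = Re (\<integral>x. \<i> * (f x * cnj (g x)) \<partial>M)"
      using Re_eq[OF Lp2_cmult[OF f]] by (simp add: mult.assoc)
    then show "Im (\<Lambda> f) = Im (\<integral>x. f x * cnj (g x) \<partial>M)"
      using f by (simp add: scale)
  qed
qed

section \<open>Unfolding integrals over translates of the period, and periodization\<close>

text \<open>A translation of the variable. The endpoint \<open>a\<close> is dropped as a null set
  because translates of the half-open period are disjoint while those of the closed one
  overlap.\<close>

lemma integral_lebesgue_on_shift:
  fixes H :: "real \<Rightarrow> 'b :: euclidean_space"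
  assumes "integrable lebesgue H"
  shows "(\<integral>t. H (t - s) \<partial>lebesgue_on {0..a})
    = (\<integral>t. indicat_real {0..<a} (t + s) *\<^sub>R H t \<partial>lebesgue)"
proof -
  have H: "integrable lebesgue (\<lambda>t. H (t - s))"
    using lebesgue_integrable_real_affine[OF assms, of 1 "- s"] by (simp add: add.commute)
  have "(\<integral>t. H (t - s) \<partial>lebesgue_on {0..a}) = (\<integral>t. indicat_real {0..a} t *\<^sub>R H (t - s) \<partial>lebesgue)"
    by (simp add: integral_restrict_space)
  also have "\<dots> = (\<integral>t. indicat_real {0..<a} t *\<^sub>R H (t - s) \<partial>lebesgue)"
  proof (rule integral_cong_AE)
    have "AE t in lebesgue. t \<noteq> a" by (auto intro!: AE_completion simp: AE_lborel_singleton)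
    then show "AE t in lebesgue. indicat_real {0..a} t *\<^sub>R H (t - s) = indicat_real {0..<a} t *\<^sub>R H (t - s)"
      by eventually_elim (auto simp: indicator_def)
  qed (use H in \<open>auto intro!: borel_measurable_scaleR borel_measurable_indicator\<close>)
  also have "\<dots> = (\<integral>t. indicat_real {0..<a} (t + s) *\<^sub>R H t \<partial>lebesgue)"
    by (subst lebesgue_integral_real_affine[of 1 _ s]) (simp_all add: add.commute)
  finally show ?thesis .
qed

text \<open>This is the tiling of the line by translates of the half-open period, on which both the
  unfolding of integrals and the periodic extension of sets rest.\<close>

lemma translate_in_period_iff:
  fixes a t :: real
  assumes "a > 0"
  shows "t + of_int n * a \<in> {0..<a} \<longleftrightarrow> n = - \<lfloor>t / a\<rfloor>"
proof -
  have "n = - \<lfloor>t / a\<rfloor> \<longleftrightarrow> \<lfloor>t / a\<rfloor> = - n" by linarith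
  also have "\<dots> \<longleftrightarrow> - of_int n \<le> t / a \<and> t / a < - of_int n + 1"
    by (simp add: floor_eq_iff)
  also have "\<dots> \<longleftrightarrow> t + of_int n * a \<in> {0..<a}"
    using assms by (auto simp: field_simps)
  finally show ?thesis by simp
qed

text \<open>Cutting \<open>H\<close> along the tiling gives pieces \<open>w k\<close> of which
  exactly one can be nonzero at each point. Hence the pieces sum to \<open>H\<close> and their norms
  to the norm of \<open>H\<close>, which justifies termwise integration. The integers are enumerated
  by \<open>int_decode\<close>; general values let the lemma serve for \<open>F\<close> and for
  \<open>cmod F\<close> below.\<close>

lemma sums_integral_translates:
  fixes H :: "real \<Rightarrow> 'b :: euclidean_space" and a :: real
  assumes "a > 0" "integrable lebesgue H"
  shows "(\<lambda>k. \<integral>t. H (t - of_int (int_decode k) * a) \<partial>lebesgue_on {0..a}) sums (\<integral>t. H t \<partial>lebesgue)"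
proof -
  define w where "w k t = indicat_real {0..<a} (t + of_int (int_decode k) * a) *\<^sub>R H t" for k t
  have w_eq: "w k t = (if k = int_encode (- \<lfloor>t / a\<rfloor>) then H t else 0)" for k t
    unfolding w_def indicator_def translate_in_period_iff[OF assms(1)]
    by (auto simp: int_encode_eq[symmetric] simp del: int_encode_eq)
  have w_sums: "(\<lambda>k. w k t) sums H t" for t
    unfolding w_eq using sums_single[of "int_encode (- \<lfloor>t / a\<rfloor>)" "\<lambda>_. H t"] by simp
  have wn_sums: "(\<lambda>k. norm (w k t)) sums norm (H t)" for t
    unfolding w_eq if_distrib[of norm] norm_zero
    using sums_single[of "int_encode (- \<lfloor>t / a\<rfloor>)" "\<lambda>_. norm (H t)"] by simp
  have w_int: "integrable lebesgue (w k)" for k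
  proof -
    have "{t. t + of_int (int_decode k) * a \<in> {0..<a}} = {- of_int (int_decode k) * a ..< a - of_int (int_decode k) * a}"
      by auto
    then have "w k = (\<lambda>t. indicat_real {- of_int (int_decode k) * a ..< a - of_int (int_decode k) * a} t *\<^sub>R H t)"
      by (auto simp: w_def fun_eq_iff indicator_def)
    then show ?thesis using assms(2) by (auto intro!: integrable_mult_indicator)
  qed
  have "summable (\<lambda>k. \<integral>t. norm (w k t) \<partial>lebesgue)"
  proof (rule summableI_nonneg_bounded)
    fix n
    have "(\<Sum>k<n. \<integral>t. norm (w k t) \<partial>lebesgue) = (\<integral>t. (\<Sum>k<n. norm (w k t)) \<partial>lebesgue)"
      using w_int by simp
    also have "\<dots> \<le> (\<integral>t. norm (H t) \<partial>lebesgue)"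
    proof (rule integral_mono)
      show "(\<Sum>k<n. norm (w k t)) \<le> norm (H t)" for t
        unfolding sums_unique[OF wn_sums] by (rule sum_le_suminf[OF sums_summable[OF wn_sums]]) auto
    qed (use assms(2) w_int in auto)
    finally show "(\<Sum>k<n. \<integral>t. norm (w k t) \<partial>lebesgue) \<le> (\<integral>t. norm (H t) \<partial>lebesgue)" .
  qed auto
  then have "(\<lambda>k. \<integral>t. w k t \<partial>lebesgue) sums (\<integral>t. (\<Sum>k. w k t) \<partial>lebesgue)"
    by (rule sums_integral[OF w_int AE_I2[OF sums_summable[OF wn_sums]]])
  then show ?thesis
    unfolding integral_lebesgue_on_shift[OF assms(2)] sums_unique[OF w_sums, symmetric]
    unfolding w_def .
qed

text \<open>With \<open>F t = f t * cnj (g t)\<close> the function \<open>P\<close> is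
  \<open>a_inner a f g\<close>. Unfolding \<open>cmod F\<close> gives absolute convergence almost
  everywhere and the norm bound; unfolding \<open>F\<close> gives the integral.\<close>

lemma periodization:
  fixes F :: "real \<Rightarrow> complex" and a :: real
  assumes "a > 0" "integrable lebesgue F"
  defines "P \<equiv> \<lambda>t. \<Sum>\<^sub>\<infinity>n\<in>(UNIV :: int set). F (t - of_int n * a)"
  shows integrable_periodization: "integrable (lebesgue_on {0..a}) P"
    and integral_periodization: "(\<integral>t. P t \<partial>lebesgue_on {0..a}) = (\<integral>t. F t \<partial>lebesgue)"
    and integral_norm_periodization_le:
      "(\<integral>t. cmod (P t) \<partial>lebesgue_on {0..a}) \<le> (\<integral>t. cmod (F t) \<partial>lebesgue)"
proof -
  define u where "u k t = F (t - of_int (int_decode k) * a)" for k t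
  define M where "M = lebesgue_on {0..a}"
  have u_int: "integrable M (u k)" for k
  proof -
    have "integrable lebesgue (u k)"
      using lebesgue_integrable_real_affine[OF assms(2), of 1 "- of_int (int_decode k) * a"]
      by (simp add: u_def[abs_def] add.commute)
    then show ?thesis
      unfolding M_def by (subst integrable_restrict_space) (auto intro!: integrable_mult_indicator)
  qed
  have u_sums: "(\<lambda>k. \<integral>t. u k t \<partial>M) sums (\<integral>t. F t \<partial>lebesgue)"
    unfolding u_def M_def by (rule sums_integral_translates[OF assms(1,2)])
  have un_sums: "(\<lambda>k. \<integral>t. cmod (u k t) \<partial>M) sums (\<integral>t. cmod (F t) \<partial>lebesgue)"
    unfolding u_def M_def by (rule sums_integral_translates[OF assms(1) integrable_norm[OF assms(2)]])
  have AE_u: "AE t in M. summable (\<lambda>k. cmod (u k t))"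
    by (rule AE_summable_norm[OF u_int sums_summable[OF un_sums]])
  \<comment> \<open>In \<open>\<complex>\<close> unconditional and absolute convergence coincide, so \<open>P\<close> takes its junk value \<open>0\<close> exactly
    where the series does not converge absolutely.\<close>
  have P_eq: "P t = (if summable (\<lambda>k. cmod (u k t)) then \<Sum>k. u k t else 0)" for t
  proof -
    have P: "P t = (\<Sum>\<^sub>\<infinity>k. u k t)"
      unfolding P_def u_def using infsum_reindex_bij_betw[OF bij_int_decode, symmetric] .
    show ?thesis
    proof (cases "summable (\<lambda>k. cmod (u k t))")
      case True
      have "((\<lambda>k. u k t) has_sum (\<Sum>k. u k t)) UNIV"
        by (intro norm_summable_imp_has_sum[OF True] summable_sums summable_norm_cancel[OF True])
      with True P show ?thesis by (simp add: infsumI)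
    next
      case False
      then have "\<not> (\<lambda>k. u k t) summable_on UNIV"
        using summable_on_iff_abs_summable_on_complex summable_on_imp_summable by blast
      with False P show ?thesis by (simp add: infsum_not_exists)
    qed
  qed
  have [measurable]: "u k \<in> borel_measurable M" for k using u_int by auto
  \<comment> \<open>Summability is recast as finiteness of an extended nonnegative series, which
    makes the case distinction in \<open>P_eq\<close> measurable in \<open>t\<close>.\<close>
  have summable_iff: "summable (\<lambda>k. cmod (u k t)) \<longleftrightarrow> (\<Sum>k. ennreal (cmod (u k t))) \<noteq> top" for t
    using ennreal_suminf_neq_top summable_suminf_not_top by (metis norm_ge_zero)
  have P_meas: "P \<in> borel_measurable M"
    unfolding P_eq[abs_def] summable_iff by measurable
  have AE_P: "AE t in M. P t = (\<Sum>k. u k t)"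
    using AE_u by eventually_elim (simp add: P_eq)
  have s_int: "integrable M (\<lambda>t. \<Sum>k. u k t)"
    by (rule integrable_suminf[OF u_int AE_u sums_summable[OF un_sums]])
  then have P_int: "integrable M P"
    using integrable_cong_AE[OF P_meas borel_measurable_integrable AE_P] by blast
  then show "integrable (lebesgue_on {0..a}) P" by (simp add: M_def)
  have "(\<integral>t. P t \<partial>M) = (\<integral>t. (\<Sum>k. u k t) \<partial>M)"
    by (rule integral_cong_AE[OF P_meas borel_measurable_integrable[OF s_int] AE_P])
  also have "\<dots> = (\<integral>t. F t \<partial>lebesgue)"
    using sums_unique[OF u_sums] integral_suminf[OF u_int AE_u sums_summable[OF un_sums]] by simp
  finally show "(\<integral>t. P t \<partial>lebesgue_on {0..a}) = (\<integral>t. F t \<partial>lebesgue)" by (simp add: M_def)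
  have AE_u': "AE t in M. summable (\<lambda>k. norm (cmod (u k t)))" using AE_u by simp
  have un: "integrable M (\<lambda>t. cmod (u k t))" "summable (\<lambda>k. \<integral>t. norm (cmod (u k t)) \<partial>M)" for k
    using u_int sums_summable[OF un_sums] by auto
  have "(\<integral>t. cmod (P t) \<partial>M) \<le> (\<integral>t. (\<Sum>k. cmod (u k t)) \<partial>M)"
  proof (rule integral_mono_AE)
    show "integrable M (\<lambda>t. \<Sum>k. cmod (u k t))"
      by (rule integrable_suminf[OF un(1) AE_u' un(2)])
    show "AE t in M. cmod (P t) \<le> (\<Sum>k. cmod (u k t))"
      using AE_u by eventually_elim (simp add: P_eq summable_norm)
  qed (use P_int in auto)
  also have "\<dots> = (\<integral>t. cmod (F t) \<partial>lebesgue)"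
    using sums_unique[OF un_sums] integral_suminf[OF un(1) AE_u' un(2)] by simp
  finally show "(\<integral>t. cmod (P t) \<partial>lebesgue_on {0..a}) \<le> (\<integral>t. cmod (F t) \<partial>lebesgue)"
    by (simp add: M_def)
qed

text \<open>Factorability speaks only of periodic multipliers, so a set within one period has to be
  made periodic: take the union of all translates of its part in \<open>{0..<a}\<close>.\<close>

lemma periodic_extension:
  fixes a :: real
  assumes "a > 0" "A \<in> sets lebesgue"
  obtains P where "P \<in> sets lebesgue" "\<And>t n. t + of_int n * a \<in> P \<longleftrightarrow> t \<in> P"
    "P \<inter> {0..<a} = A \<inter> {0..<a}"
proof
  define P where "P = (\<Union>n::int. (+) (of_int n * a) ` (A \<inter> {0..<a}))"
  have P: "t \<in> P \<longleftrightarrow> (\<exists>n. t + of_int n * a \<in> A \<inter> {0..<a})" for t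
  proof
    assume "t \<in> P"
    then obtain n s where "s \<in> A \<inter> {0..<a}" "t = of_int n * a + s" by (auto simp: P_def)
    then have "t + of_int (- n) * a \<in> A \<inter> {0..<a}" by simp
    then show "\<exists>n. t + of_int n * a \<in> A \<inter> {0..<a}" ..
  next
    assume "\<exists>n. t + of_int n * a \<in> A \<inter> {0..<a}"
    then obtain n where "t + of_int n * a \<in> A \<inter> {0..<a}" ..
    then have "of_int (- n) * a + (t + of_int n * a) \<in> P" unfolding P_def by blast
    then show "t \<in> P" by simp
  qed
  have "(+) (of_int n * a) ` (A \<inter> {0..<a}) \<in> sets lebesgue" for n
    by (rule lebesgue_sets_translation) (use assms(2) in auto)
  then show "P \<in> sets lebesgue"
    unfolding P_def by auto
  show "t + of_int n * a \<in> P \<longleftrightarrow> t \<in> P" for t n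
  proof
    assume "t + of_int n * a \<in> P"
    then obtain k where "t + of_int n * a + of_int k * a \<in> A \<inter> {0..<a}" unfolding P ..
    then have "t + of_int (n + k) * a \<in> A \<inter> {0..<a}" by (simp add: algebra_simps)
    then show "t \<in> P" unfolding P ..
  next
    assume "t \<in> P"
    then obtain k where "t + of_int k * a \<in> A \<inter> {0..<a}" unfolding P ..
    then have "t + of_int n * a + of_int (k - n) * a \<in> A \<inter> {0..<a}" by (simp add: algebra_simps)
    then show "t + of_int n * a \<in> P" unfolding P ..
  qed
  \<comment> \<open>By the tiling, no other translate reaches back into \<open>{0..<a}\<close>, so
    the union adds no points there.\<close>
  have "n = 0" if "t \<in> {0..<a}" "t + of_int n * a \<in> {0..<a}" for t n
    using that translate_in_period_iff[OF assms(1), of t n] translate_in_period_iff[OF assms(1), of t 0]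
    by simp
  then show "P \<inter> {0..<a} = A \<inter> {0..<a}"
    unfolding set_eq_iff Int_iff P
    by (metis add.right_neutral mult_zero_left of_int_0)
qed

section \<open>Representation of a factorable operator and computation of its norm\<close>

theorem theorem5p8:
  fixes a :: real and L :: "(real \<Rightarrow> complex) \<Rightarrow> real \<Rightarrow> complex"
  assumes "a > 0"
    and "Lp_linear 2 lebesgue 1 (lebesgue_on {0..a}) L"
    and "Lp_bounded 2 lebesgue 1 (lebesgue_on {0..a}) L"
    and "a_factorable a {0..a} L"
  shows "\<exists>g\<in>Lp 2 lebesgue.
           (\<forall>f\<in>Lp 2 lebesgue. AE t in lebesgue_on {0..a}. L f t = a_inner a f g t) \<and>
           Lp_opnorm 2 lebesgue 1 (lebesgue_on {0..a}) L = Lp_norm 2 lebesgue g"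
proof -
  define E where "E = lebesgue_on {0..a}"
  define \<Lambda> where "\<Lambda> f = (\<integral>t. L f t \<partial>E)" for f
  have L_int: "integrable E (L f)" if "f \<in> Lp 2 lebesgue" for f
    using assms(2) that by (simp add: Lp_linear_def Lp1_iff E_def)
  then have [measurable]: "L f \<in> borel_measurable E" if "f \<in> Lp 2 lebesgue" for f
    using that by auto
  have \<Lambda>_le: "cmod (\<Lambda> f) \<le> Lp_norm 1 E (L f)" for f
    unfolding \<Lambda>_def Lp1_norm by (rule integral_norm_bound)
  obtain C where C: "\<And>f. f \<in> Lp 2 lebesgue \<Longrightarrow> Lp_norm 1 E (L f) \<le> C * Lp_norm 2 lebesgue f"
    using assms(3) unfolding Lp_bounded_def E_def by blast
  \<comment> \<open>\<open>L\<close> is linear only up to null sets; integration makes the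
    identities exact, as \<open>Lp2_Riesz\<close> requires.\<close>
  have \<Lambda>_add: "\<Lambda> (\<lambda>x. f x + h x) = \<Lambda> f + \<Lambda> h" if f: "f \<in> Lp 2 lebesgue" and h: "h \<in> Lp 2 lebesgue" for f h
  proof -
    have "AE t in E. L (\<lambda>x. f x + h x) t = L f t + L h t"
      using assms(2) f h unfolding Lp_linear_def E_def by blast
    then have "\<Lambda> (\<lambda>x. f x + h x) = (\<integral>t. L f t + L h t \<partial>E)"
      unfolding \<Lambda>_def using L_int[OF f] L_int[OF h] L_int[OF Lp2_add[OF f h]]
      by (intro integral_cong_AE) auto
    then show ?thesis using L_int[OF f] L_int[OF h] by (simp add: \<Lambda>_def)
  qed
  have \<Lambda>_scale: "\<Lambda> (\<lambda>x. c * f x) = c * \<Lambda> f" if f: "f \<in> Lp 2 lebesgue" for c f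
  proof -
    have "AE t in E. L (\<lambda>x. c * f x) t = c * L f t"
      using assms(2) f unfolding Lp_linear_def E_def by blast
    then have "\<Lambda> (\<lambda>x. c * f x) = (\<integral>t. c * L f t \<partial>E)"
      unfolding \<Lambda>_def using L_int[OF f] L_int[OF Lp2_cmult[OF f]]
      by (intro integral_cong_AE) auto
    then show ?thesis by (simp add: \<Lambda>_def)
  qed
  have \<Lambda>_bound: "cmod (\<Lambda> f) \<le> C * Lp_norm 2 lebesgue f" if "f \<in> Lp 2 lebesgue" for f
    using \<Lambda>_le C[OF that] by (rule order_trans)
  obtain g where g: "g \<in> Lp 2 lebesgue"
    and \<Lambda>_eq: "\<And>f. f \<in> Lp 2 lebesgue \<Longrightarrow> \<Lambda> f = (\<integral>t. f t * cnj (g t) \<partial>lebesgue)"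
    using Lp2_Riesz[of lebesgue \<Lambda> C] \<Lambda>_add \<Lambda>_scale \<Lambda>_bound by blast
  have inner_int: "integrable E (a_inner a f g)"
    and inner_integral: "(\<integral>t. a_inner a f g t \<partial>E) = (\<integral>t. f t * cnj (g t) \<partial>lebesgue)"
    and inner_norm: "(\<integral>t. cmod (a_inner a f g t) \<partial>E) \<le> (\<integral>t. cmod (f t * cnj (g t)) \<partial>lebesgue)"
    if "f \<in> Lp 2 lebesgue" for f
    using periodization[OF assms(1) Lp2_integrable_mult_cnj[OF that g]]
    unfolding a_inner_def[abs_def] E_def by auto
  \<comment> \<open>The periodic extension agrees with the given set only on the half-open period,
    so the endpoint \<open>a\<close> is discarded.\<close>
  have AE_neq: "AE t in E. t \<in> {0..<a}"
  proof -
    have "AE t in lebesgue. t \<noteq> a" by (auto intro!: AE_completion simp: AE_lborel_singleton)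
    then have "AE t in lebesgue. t \<in> {0..a} \<longrightarrow> t \<in> {0..<a}" by eventually_elim auto
    then show ?thesis unfolding E_def by (subst AE_restrict_space_iff) simp_all
  qed
  have L_eq: "AE t in E. L f t = a_inner a f g t" if f: "f \<in> Lp 2 lebesgue" for f
  proof -
    interpret finite_measure E unfolding E_def by (rule finite_measure_lebesgue_on) simp
    show ?thesis
    proof (rule density_unique_banach[OF L_int[OF f] inner_int[OF f]])
      fix A assume A: "A \<in> sets E"
      then have "A \<in> sets lebesgue"
        unfolding E_def by (auto simp: sets_restrict_space)
      then obtain P where P [measurable]: "P \<in> sets lebesgue"
        and per: "\<And>t n. t + of_int n * a \<in> P \<longleftrightarrow> t \<in> P" and PA: "P \<inter> {0..<a} = A \<inter> {0..<a}"
        using periodic_extension[OF assms(1)] by blast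
      \<comment> \<open>The factor \<open>\<phi>\<close> comes out of \<open>L\<close> by
        factorability and out of \<open>a_inner\<close> because it is constant along translates.
        Being almost everywhere the indicator of \<open>A\<close> on the period, it turns the two
        expressions for \<open>\<Lambda> (\<lambda>t. \<phi> t * f t)\<close> into the two integrals
        over \<open>A\<close>.\<close>
      define \<phi> where "\<phi> t = complex_of_real (indicat_real P t)" for t
      have \<phi>_meas: "\<phi> \<in> borel_measurable lebesgue"
        unfolding \<phi>_def by measurable
      have \<phi>_per: "\<phi> (t + of_int n * a) = \<phi> t" for t n
        by (simp only: \<phi>_def indicator_def per)
      have \<phi>_per': "\<phi> (t - of_int n * a) = \<phi> t" for t n
        using \<phi>_per[of t "- n"] unfolding of_int_minus mult_minus_left add_uminus_conv_diff .
      have AE_\<phi>: "AE t in E. \<phi> t = indicat_real A t"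
        using AE_neq
      proof eventually_elim
        case (elim t)
        then have "t \<in> P \<longleftrightarrow> t \<in> A" using PA by blast
        then show ?case by (simp add: \<phi>_def indicator_def)
      qed
      have \<phi>f: "(\<lambda>t. \<phi> t * f t) \<in> Lp 2 lebesgue"
        by (rule Lp2_bounded_mult[OF f \<phi>_meas]) (simp add: \<phi>_def indicator_def)
      have "AE t in E. L (\<lambda>t. \<phi> t * f t) t = \<phi> t * L f t"
        unfolding E_def
      proof (rule assms(4)[unfolded a_factorable_def, rule_format, OF \<phi>f f \<phi>_meas])
        show "\<phi> (t + a) = \<phi> t" for t using \<phi>_per[of t 1] by simp
      qed simp
      then have "AE t in E. L (\<lambda>t. \<phi> t * f t) t = indicat_real A t *\<^sub>R L f t"
        using AE_\<phi> by eventually_elim (simp add: scaleR_conv_of_real)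
      then have "set_lebesgue_integral E A (L f) = \<Lambda> (\<lambda>t. \<phi> t * f t)"
        unfolding set_lebesgue_integral_def \<Lambda>_def
        using L_int[OF f] L_int[OF \<phi>f] A by (intro integral_cong_AE) auto
      also have "\<dots> = (\<integral>t. a_inner a (\<lambda>t. \<phi> t * f t) g t \<partial>E)"
        using \<Lambda>_eq[OF \<phi>f] inner_integral[OF \<phi>f] by simp
      also have "\<dots> = set_lebesgue_integral E A (a_inner a f g)"
        unfolding set_lebesgue_integral_def
      proof (rule integral_cong_AE)
        \<comment> \<open>This holds at every \<open>t\<close>, even where the sum diverges: for a
          nonzero factor both sums then take the default value 0, and for a zero factor both sides
          vanish.\<close>
        have inner_\<phi>: "a_inner a (\<lambda>t. \<phi> t * f t) g t = \<phi> t * a_inner a f g t" for t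
          unfolding a_inner_def \<phi>_per' mult.assoc by (rule infsum_cmult_right')
        show "AE t in E. a_inner a (\<lambda>t. \<phi> t * f t) g t = indicat_real A t *\<^sub>R a_inner a f g t"
          using AE_\<phi> by eventually_elim (simp add: inner_\<phi> scaleR_conv_of_real)
      qed (use inner_int[OF f] inner_int[OF \<phi>f] A in auto)
      finally show "set_lebesgue_integral E A (L f) = set_lebesgue_integral E A (a_inner a f g)" .
    qed
  qed
  have norm_le: "Lp_norm 1 E (L f) \<le> Lp_norm 2 lebesgue f * Lp_norm 2 lebesgue g"
    if f: "f \<in> Lp 2 lebesgue" for f
  proof -
    have "Lp_norm 1 E (L f) = (\<integral>t. cmod (a_inner a f g t) \<partial>E)"
      unfolding Lp1_norm using L_eq[OF f] L_int[OF f] inner_int[OF f]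
      by (intro integral_cong_AE) auto
    also note inner_norm[OF f]
    also note Lp2_Cauchy_Schwarz[OF f g]
    finally show ?thesis .
  qed
  define N where "N = Lp_norm 2 lebesgue g"
  have N0: "N \<ge> 0" by (simp add: N_def Lp2_norm)
  have "Lp_opnorm 2 lebesgue 1 E L = N"
    unfolding Lp_opnorm_def
  \<comment> \<open>The supremum is a maximum: \<open>N\<close> is an upper bound by
    \<open>norm_le\<close> and is attained at the normalized \<open>g\<close>.\<close>
  proof (rule cSup_eq_maximum)
    show "y \<le> N" if "y \<in> (\<lambda>f. Lp_norm 1 E (L f)) ` {f \<in> Lp 2 lebesgue. Lp_norm 2 lebesgue f \<le> 1}" for y
    proof -
      from that obtain f where f: "f \<in> Lp 2 lebesgue" "Lp_norm 2 lebesgue f \<le> 1" "y = Lp_norm 1 E (L f)"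
        by blast
      have "Lp_norm 2 lebesgue f * N \<le> 1 * N" using f(2) N0 by (rule mult_right_mono)
      with norm_le[OF f(1)] f(3) show ?thesis by (simp add: N_def)
    qed
    \<comment> \<open>For \<open>N = 0\<close> the witness is the zero function, since then \<open>1 / N = 0\<close>.\<close>
    define f where "f = (\<lambda>t. complex_of_real (1 / N) * g t)"
    have f: "f \<in> Lp 2 lebesgue" unfolding f_def by (rule Lp2_cmult[OF g])
    have "Lp_norm 2 lebesgue f = sqrt ((1 / N)\<^sup>2 * (\<integral>t. (cmod (g t))\<^sup>2 \<partial>lebesgue))"
      unfolding f_def Lp2_norm norm_mult power_mult_distrib norm_of_real power2_abs by simp
    also have "\<dots> = sqrt ((1 / N)\<^sup>2 * N\<^sup>2)" by (simp only: N_def Lp2_norm_square)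
    \<comment> \<open>The value is 1 when \<open>N\<close> is nonzero and 0 when
      \<open>N = 0\<close>.\<close>
    also have "\<dots> \<le> 1" by (simp add: power_mult_distrib[symmetric])
    finally have f1: "Lp_norm 2 lebesgue f \<le> 1" .
    \<comment> \<open>The lower bound goes through the functional: \<open>\<Lambda> f\<close> comes
      out as \<open>N\<close>, and its modulus is at most the \<open>L^1\<close> norm of
      \<open>L f\<close>.\<close>
    have "\<Lambda> f = complex_of_real (1 / N) * (\<integral>t. g t * cnj (g t) \<partial>lebesgue)"
      unfolding \<Lambda>_eq[OF f] unfolding f_def mult.assoc by (rule integral_mult_right_zero)
    also have "(\<integral>t. g t * cnj (g t) \<partial>lebesgue) = complex_of_real (N\<^sup>2)"
      unfolding complex_norm_square[symmetric] of_real_power[symmetric] N_def Lp2_norm_square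
      by (rule integral_complex_of_real)
    finally have "\<Lambda> f = complex_of_real N" by (simp add: power2_eq_square)
    then have "N \<le> Lp_norm 1 E (L f)" using \<Lambda>_le[of f] N0 by simp
    moreover have "Lp_norm 1 E (L f) \<le> N"
      using norm_le[OF f] mult_right_mono[OF f1 N0] by (simp add: N_def)
    ultimately show "N \<in> (\<lambda>f. Lp_norm 1 E (L f)) ` {f \<in> Lp 2 lebesgue. Lp_norm 2 lebesgue f \<le> 1}"
      using f f1 by (intro image_eqI[of _ _ f]) auto
  qed
  with g L_eq show ?thesis unfolding N_def E_def by blast
qed

end
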